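(* Let $v\ge 3$, let $s\ge 1$ be an integer, let $\mathbf s=(s,\dots,s)$ be the regular $v$-vector, and let $m\le sv$ be a non-negative integer. If $\mathbf s=(1,1,1)$ and $m=3$, then there are exactly $7$ optimal advance bids for the $\mathbf s$-deck: $(1,1,1)$ and the permutations of $(2,1,0)$. Otherwise, the optimal advance bids for the $m$-round $\mathbf s$-game are precisely the almost regular $v$-vectors with sum $m$, i.e. the vectors $(b_1,\dots,b_v)$ of non-negative integers with $b_1+\dots+b_v=m$ and $b_i\in\{\lfloor m/v\rfloor,\lceil m/v\rceil\}$ for all $i$.
   Context: For a vector $\mathbf s=(s_1,\dots,s_v)$ of non-negative integers, the $\mathbf s$-deck consists of $s_i$ cards of Value $i$; $\Sigma(\mathbf s)=s_1+\dots+s_v$. In the $m$-round $\mathbf s$-game, the deck is shuffled uniformly at random; in each of $m$ rounds the player names a value in $\{1,\dots,v\}$ and then the top card of the remaining deck is turned face up; the player loses if in some round the turned card has the named value, and wins otherwise. An advance strategy is one where the whole sequence of $m$ bids is fixed before any card is turned; since the winning probability does not depend on the order of the bids, it is encoded by the bid vector $\mathbf b=(b_1,\dots,b_v)$ of non-negative integers with $\Sigma(\mathbf b)=m$, where $b_i$ is the number of times Value $i$ is named. Let $\Pr(\mathbf b,\mathbf s)$ be the probability that $\mathbf b$ wins. An advance bid $\mathbf b$ with $\Sigma(\mathbf b)=m$ is optimal for the $\mathbf s$-deck if $\Pr(\mathbf b',\mathbf s)\le \Pr(\mathbf b,\mathbf s)$ for every non-negative integer $v$-vector $\mathbf b'$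 with $\Sigma(\mathbf b')=m$. *)

theory Defs
  imports "HOL-Probability.Probability" "HOL-Combinatorics.Combinatorics"
begin

text \<open>A \<open>v\<close>-vector is a list of length \<open>v\<close>; Value \<open>i\<close> is represented by the 0-based index
  \<open>i - 1\<close>. A card is a pair \<open>(i, j)\<close>, the \<open>j\<close>-th copy of value \<open>i\<close>, so that all cards are
  distinguishable and a shuffle is a uniformly random ordering of the set of cards.\<close>

definition deck :: "nat list \<Rightarrow> (nat \<times> nat) set" where
  "deck s = (SIGMA i:{..<length s}. {..<s ! i})"

definition shuffled_deck :: "nat list \<Rightarrow> (nat \<times> nat) list pmf" where
  "shuffled_deck s = pmf_of_set (permutations_of_set (deck s))"

definition wins :: "nat list \<Rightarrow> (nat \<times> nat) list \<Rightarrow> bool" where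
  "wins bids d \<longleftrightarrow> (\<forall>r<length bids. fst (d ! r) \<noteq> bids ! r)"

text \<open>Only meaningful if the number of rounds \<open>length bids\<close> is at most \<open>sum_list s\<close>.\<close>

definition seq_win_prob :: "nat list \<Rightarrow> nat list \<Rightarrow> real" where
  "seq_win_prob bids s = measure_pmf.prob (shuffled_deck s) {d. wins bids d}"

definition bid_seq :: "nat list \<Rightarrow> nat list" where
  "bid_seq b = concat (map (\<lambda>i. replicate (b ! i) i) [0..<length b])"

text \<open>The bids are made in increasing order of value; by \<open>win_prob_eq_seq_win_prob\<close> below, any other
  order gives the same probability.\<close>

definition win_prob :: "nat list \<Rightarrow> nat list \<Rightarrow> real" where
  "win_prob b s = seq_win_prob (bid_seq b) s"

definition optimal_bids :: "nat list \<Rightarrow> nat \<Rightarrow> nat list set" where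
  "optimal_bids s m = {b. length b = length s \<and> sum_list b = m \<and>
     (\<forall>b'. length b' = length s \<and> sum_list b' = m \<longrightarrow> win_prob b' s \<le> win_prob b s)}"

definition almost_regular :: "nat \<Rightarrow> nat \<Rightarrow> nat list set" where
  "almost_regular v m = {b. length b = v \<and> sum_list b = m \<and>
     (\<forall>i<v. int (b ! i) \<in> {\<lfloor>real m / real v\<rfloor>, \<lceil>real m / real v\<rceil>})}"

lemma finite_deck [simp]: "finite (deck s)"
  by (simp add: deck_def)

lemma card_deck: "card (deck s) = sum_list s"
  by (simp add: deck_def card_SigmaI sum_list_sum_nth atLeast0LessThan)

lemma seq_win_prob_mono_mset:
  assumes "mset xs = mset ys" "length xs \<le> sum_list s"
  shows "seq_win_prob ys s \<le> seq_win_prob xs s"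
proof -
  obtain f where f: "f permutes {..<length ys}" "permute_list f ys = xs"
    using assms(1) by (rule mset_eq_permutation)
  have len: "length xs = length ys" using assms(1) by (rule mset_eq_length)
  define N where "N = sum_list s"
  have le: "length ys \<le> N" using assms(2) len by (simp add: N_def)
  have fN: "f permutes {..<N}" by (rule permutes_subset[OF f(1)]) (use le in auto)
  define A where "A = permutations_of_set (deck s)"
  have lenA: "length d = N" if "d \<in> A" for d
    using that length_finite_permutations_of_set[of d "deck s"]
    by (simp add: A_def N_def card_deck)
  have inj: "inj_on (permute_list f) (A \<inter> {d. wins ys d})"
  proof (rule inj_onI)
    fix d e assume d: "d \<in> A \<inter> {d. wins ys d}" and e: "e \<in> A \<inter> {d. wins ys d}"
      and eq: "permute_list f d = permute_list f e"
    have l: "length d = N" "length e = N" using d e lenA by auto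
    show "d = e"
    proof (rule nth_equalityI)
      fix i assume i: "i < length d"
      have iN: "i < N" using i l by simp
      have "inv f permutes {..<N}" using fN by (rule permutes_inv)
      from permutes_in_image[OF this, of i] have "inv f i < N" using iN by simp
      moreover have "f (inv f i) = i" using permutes_inverses(1)[OF fN] .
      ultimately show "d ! i = e ! i"
        using permute_list_nth[of f d "inv f i"] permute_list_nth[of f e "inv f i"] fN l eq by simp
    qed (simp add: l)
  qed
  have img: "permute_list f ` (A \<inter> {d. wins ys d}) \<subseteq> A \<inter> {d. wins xs d}"
  proof safe
    fix d assume d: "d \<in> A" and w: "wins ys d"
    have ld: "length d = N" using d by (rule lenA)
    show "permute_list f d \<in> A"
      using d fN ld by (auto simp: A_def permutations_of_set_def)
    show "wins xs (permute_list f d)"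
      unfolding wins_def
    proof (intro allI impI)
      fix r assume r: "r < length xs"
      have ry: "r < length ys" using r len by simp
      have fr: "f r < length ys" using permutes_in_image[OF f(1), of r] ry by simp
      have "permute_list f d ! r = d ! f r"
        using permute_list_nth[of f d r] fN ld ry le by simp
      moreover have "xs ! r = ys ! f r"
        using permute_list_nth[of f ys r] f ry by simp
      ultimately show "fst (permute_list f d ! r) \<noteq> xs ! r"
        using w fr by (simp add: wins_def)
    qed
  qed
  have "card (A \<inter> {d. wins ys d}) \<le> card (A \<inter> {d. wins xs d})"
    by (rule card_inj_on_le[OF inj img]) (simp add: A_def)
  then show ?thesis
    unfolding seq_win_prob_def shuffled_deck_def A_def[symmetric]
    by (subst (1 2) measure_pmf_of_set) (auto simp: A_def intro!: divide_right_mono)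
qed

lemma seq_win_prob_cong_mset:
  assumes "mset xs = mset ys" "length xs \<le> sum_list s"
  shows "seq_win_prob xs s = seq_win_prob ys s"
  using seq_win_prob_mono_mset[OF assms] seq_win_prob_mono_mset[of ys xs s] assms
    mset_eq_length[OF assms(1)] by simp

lemma count_bid_seq: "count (mset (bid_seq b)) i = (if i < length b then b ! i else 0)"
proof -
  have "count (mset (concat (map (\<lambda>i. replicate (b ! i) i) [0..<n]))) i = (if i < n then b ! i else 0)" for n
    by (induction n) (auto simp: less_Suc_eq)
  then show ?thesis by (simp add: bid_seq_def)
qed

lemma length_bid_seq: "length (bid_seq b) = sum_list b"
  by (simp add: bid_seq_def length_concat comp_def map_nth)

theorem win_prob_eq_seq_win_prob:
  assumes "\<And>i. count (mset bids) i = (if i < length b then b ! i else 0)" "sum_list b \<le> sum_list s"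
  shows "seq_win_prob bids s = win_prob b s"
proof -
  have "mset (bid_seq b) = mset bids"
    by (rule multiset_eqI) (simp only: assms(1) count_bid_seq)
  then show ?thesis
    using seq_win_prob_cong_mset[of "bid_seq b" bids s] assms(2)
    by (simp add: win_prob_def length_bid_seq)
qed

end

theory Submission
  imports Defs
begin

text \<open>
  Compare a bid naming \<open>x\<close> exactly \<open>a + 1\<close> times and \<open>y\<close> exactly \<open>c\<close> times with the bid obtained by
  changing one \<open>x\<close> to \<open>y\<close>. In the rounds naming other values, cards of value \<open>x\<close> and \<open>y\<close> are
  interchangeable, so if \<open>\<alpha>\<close> of the other \<open>x\<close>-rounds turn a \<open>y\<close>-card and \<open>\<gamma>\<close> of the \<open>y\<close>-rounds turn
  an \<open>x\<close>-card, what happens elsewhere depends only on \<open>\<alpha> + \<gamma>\<close>. Counting decks, the gain of the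
  exchange becomes, with falling factorials \<open>(s)\<^sub>k\<close> and some \<open>K \<ge> 0\<close>,
  \<open>\<Sum>\<alpha> \<gamma>. (a choose \<alpha>) (c choose \<gamma>) (s)\<^sub>\<alpha> (s)\<^sub>\<gamma> (\<alpha> - \<gamma>) K (\<alpha> + \<gamma>)\<close>.
  Antisymmetrising in \<open>\<alpha>\<close>, \<open>\<gamma>\<close>, every term is nonnegative when \<open>c \<le> a\<close>, because
  \<open>(a choose \<gamma>) (c choose \<alpha>) \<le> (a choose \<alpha>) (c choose \<gamma>)\<close> for \<open>\<gamma> \<le> \<alpha>\<close>. Hence levelling a bid never
  hurts, and almost regular bids are optimal. The gain is positive for \<open>c < a\<close> as soon as some
  \<open>K (\<alpha> + \<gamma>)\<close> with \<open>\<gamma> < \<alpha>\<close> is; as \<open>K\<close> itself counts winning draws, a greedy argument decides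
  this. It fails only for a few unbalanced bids, all of which except \<open>(2, 1, 0)\<close> with \<open>s = 1\<close> can be
  levelled into a bid that admits a strict improvement.
\<close>

section \<open>Winning decks counted by successive draws\<close>

text \<open>The number of ways to draw one card for each bid in \<open>bs\<close>, without replacement and never
  turning the named value, from a deck of distinguishable cards with \<open>n i\<close> cards of value \<open>i\<close>.\<close>

fun draws :: "nat \<Rightarrow> nat list \<Rightarrow> (nat \<Rightarrow> nat) \<Rightarrow> nat" where
  "draws v [] n = 1"
| "draws v (b # bs) n = (\<Sum>i\<in>{..<v} - {b}. n i * draws v bs (n(i := n i - 1)))"

text \<open>Condition on the first card \<open>c\<close>: deleting it lowers the count of its value
  by one, and grouping the admissible \<open>c\<close> by value yields the factor \<open>n i\<close>
  of \<open>draws\<close>. The cards left after the last bid may come in any order, whence the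
  factorial.\<close>

lemma card_winning_permutations:
  assumes "finite D" "fst ` D \<subseteq> {..<v}" "length bs \<le> card D"
  shows "card {d \<in> permutations_of_set D. wins bs d} =
    draws v bs (\<lambda>i. card {c \<in> D. fst c = i}) * fact (card D - length bs)"
  using assms
proof (induction bs arbitrary: D)
  case Nil
  then show ?case by (simp add: wins_def)
next
  case (Cons b bs)
  define n where "n = (\<lambda>i. card {c \<in> D. fst c = i})"
  define f where "f = (fact (card D - length (b # bs)) :: nat)"
  have ne: "D \<noteq> {}" using Cons.prems by auto
  have split: "{d \<in> permutations_of_set D. wins (b # bs) d} =
      (\<Union>c\<in>{c \<in> D. fst c \<noteq> b}. (#) c ` {d \<in> permutations_of_set (D - {c}). wins bs d})"
  proof -
    have "wins (b # bs) (c # d) \<longleftrightarrow> fst c \<noteq> b \<and> wins bs d" for c d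
      by (auto simp: wins_def less_Suc_eq_0_disj)
    then show ?thesis
      unfolding permutations_of_set_nonempty[OF ne] by blast
  qed
  have step: "card ((#) c ` {d \<in> permutations_of_set (D - {c}). wins bs d}) =
      draws v bs (n(fst c := n (fst c) - 1)) * f" if c: "c \<in> D" for c
  proof -
    have n': "(\<lambda>i. card {e \<in> D - {c}. fst e = i}) = n(fst c := n (fst c) - 1)"
    proof
      fix i
      have "{e \<in> D - {c}. fst e = i} = (if i = fst c then {e \<in> D. fst e = i} - {c} else {e \<in> D. fst e = i})"
        by auto
      then show "card {e \<in> D - {c}. fst e = i} = (n(fst c := n (fst c) - 1)) i"
        using c Cons.prems by (simp add: n_def)
    qed
    have "card ((#) c ` {d \<in> permutations_of_set (D - {c}). wins bs d}) =
        card {d \<in> permutations_of_set (D - {c}). wins bs d}"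
      by (rule card_image) simp
    also have "\<dots> = draws v bs (\<lambda>i. card {e \<in> D - {c}. fst e = i}) * fact (card (D - {c}) - length bs)"
      by (rule Cons.IH) (use Cons.prems c in \<open>auto simp: card_Diff_singleton\<close>)
    finally show ?thesis
      unfolding n' using c Cons.prems by (simp add: f_def card_Diff_singleton)
  qed
  have "card {d \<in> permutations_of_set D. wins (b # bs) d} =
      (\<Sum>c | c \<in> D \<and> fst c \<noteq> b. draws v bs (n(fst c := n (fst c) - 1)) * f)"
    unfolding split using Cons.prems(1) by (subst card_UN_disjoint) (auto simp: step intro!: sum.cong)
  also have "\<dots> = (\<Sum>i\<in>{..<v} - {b}. \<Sum>c | c \<in> {c \<in> D. fst c \<noteq> b} \<and> fst c = i.
      draws v bs (n(fst c := n (fst c) - 1)) * f)"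
    by (rule sum.group[symmetric]) (use Cons.prems in auto)
  also have "\<dots> = (\<Sum>i\<in>{..<v} - {b}. n i * draws v bs (n(i := n i - 1)) * f)"
  proof (rule sum.cong[OF refl])
    fix i assume i: "i \<in> {..<v} - {b}"
    have "{c. c \<in> {c \<in> D. fst c \<noteq> b} \<and> fst c = i} = {c \<in> D. fst c = i}" using i by auto
    then show "(\<Sum>c | c \<in> {c \<in> D. fst c \<noteq> b} \<and> fst c = i. draws v bs (n(fst c := n (fst c) - 1)) * f) =
        n i * draws v bs (n(i := n i - 1)) * f"
      by (simp add: n_def)
  qed
  finally show ?case
    by (simp add: n_def f_def sum_distrib_right)
qed

lemma draws_cong:
  assumes "\<And>i. i < v \<Longrightarrow> n i = n' i"
  shows "draws v bs n = draws v bs n'"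
  using assms
proof (induction bs arbitrary: n n')
  case (Cons b bs)
  have "draws v bs (n(i := n i - 1)) = draws v bs (n'(i := n' i - 1))" if "i < v" for i
    by (rule Cons.IH) (use Cons.prems that in auto)
  then show ?case by (simp add: Cons.prems)
qed simp

text \<open>The order \<open>bids\<close> is left free so that the bids on two values under
  comparison can be put first.\<close>

lemma win_prob_eq_draws:
  assumes "\<And>i. count (mset bids) i = (if i < length b then b ! i else 0)" "sum_list b \<le> sum_list s"
    "length b = length s"
  shows "win_prob b s = real (draws (length s) bids ((!) s)) * fact (sum_list s - sum_list b) / fact (sum_list s)"
proof -
  have "mset (bid_seq b) = mset bids"
    by (rule multiset_eqI) (simp only: assms(1) count_bid_seq)
  then have len: "length bids = sum_list b" by (metis length_bid_seq mset_eq_length)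
  have copies: "card {c \<in> deck s. fst c = i} = s ! i" if "i < length s" for i
  proof -
    have "{c \<in> deck s. fst c = i} = {i} \<times> {..<s ! i}" using that by (auto simp: deck_def)
    then show ?thesis by (simp add: card_cartesian_product)
  qed
  have "card (permutations_of_set (deck s) \<inter> {d. wins bids d}) = card {d \<in> permutations_of_set (deck s). wins bids d}"
    by (rule arg_cong[of _ _ card]) auto
  also have "\<dots> = draws (length s) bids (\<lambda>i. card {c \<in> deck s. fst c = i}) * fact (sum_list s - sum_list b)"
    by (subst card_winning_permutations[where v = "length s"])
       (use assms(2) len in \<open>auto simp: card_deck, auto simp: deck_def\<close>)
  also have "draws (length s) bids (\<lambda>i. card {c \<in> deck s. fst c = i}) = draws (length s) bids ((!) s)"
    by (rule draws_cong) (rule copies)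
  finally have "card (permutations_of_set (deck s) \<inter> {d. wins bids d}) =
      draws (length s) bids ((!) s) * fact (sum_list s - sum_list b)" .
  then show ?thesis
    unfolding win_prob_eq_seq_win_prob[OF assms(1,2), symmetric] seq_win_prob_def shuffled_deck_def
    by (subst measure_pmf_of_set) (auto simp: card_deck)
qed

lemma sum_lessThan_split2:
  fixes f :: "nat \<Rightarrow> 'a::comm_monoid_add"
  assumes "x < v" "y < v" "x \<noteq> y"
  shows "sum f {..<v} = f x + f y + sum f ({..<v} - {x, y})"
proof -
  have "{..<v} = insert x (insert y ({..<v} - {x, y}))" using assms by auto
  then have "sum f {..<v} = sum f (insert x (insert y ({..<v} - {x, y})))" by simp
  then show ?thesis using assms by (simp add: add.assoc)
qed

section \<open>Expansion over the rounds that name one of two values\<close>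

text \<open>Bids naming neither \<open>x\<close> nor \<open>y\<close> cannot tell their cards apart.
  In the induction, drawing either one leaves the same total, so both draws reduce to the
  representative \<open>n(x := k, y := 0)\<close>.\<close>

lemma draws_merge:
  assumes "x < v" "y < v" "x \<noteq> y" "x \<notin> set bs" "y \<notin> set bs"
    and "n x + n y = n' x + n' y" "\<And>i. i \<noteq> x \<Longrightarrow> i \<noteq> y \<Longrightarrow> n i = n' i"
  shows "draws v bs n = draws v bs n'"
  using assms(4-)
proof (induction bs arbitrary: n n')
  case (Cons b bs)
  define k where "k = n x + n y - 1"
  have split: "sum f ({..<v} - {b}) = f x + f y + sum f ({..<v} - {b} - {x, y})" for f :: "nat \<Rightarrow> nat"
  proof -
    have "{..<v} - {b} = insert x (insert y ({..<v} - {b} - {x, y}))" using assms(1-3) Cons.prems by auto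
    then have "sum f ({..<v} - {b}) = sum f (insert x (insert y ({..<v} - {b} - {x, y})))" by simp
    then show ?thesis using assms(3) by (simp add: add.assoc)
  qed
  have wild: "n1 x * draws v bs (n1(x := n1 x - 1)) + n1 y * draws v bs (n1(y := n1 y - 1)) =
      (n x + n y) * draws v bs (n(x := k, y := 0))"
    if n1: "n1 x + n1 y = n x + n y" "\<And>i. i \<noteq> x \<Longrightarrow> i \<noteq> y \<Longrightarrow> n1 i = n i" for n1
  proof -
    \<comment> \<open>The case split guards the truncated subtraction: at count 0 the total would
      not drop, but the factor vanishes.\<close>
    have "n1 x * draws v bs (n1(x := n1 x - 1)) = n1 x * draws v bs (n(x := k, y := 0))"
    proof (cases "n1 x = 0")
      case False
      have "draws v bs (n1(x := n1 x - 1)) = draws v bs (n(x := k, y := 0))"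
        by (rule Cons.IH) (use Cons.prems n1 assms(3) False in \<open>auto simp: k_def\<close>)
      then show ?thesis by simp
    qed simp
    moreover have "n1 y * draws v bs (n1(y := n1 y - 1)) = n1 y * draws v bs (n(x := k, y := 0))"
    proof (cases "n1 y = 0")
      case False
      have "draws v bs (n1(y := n1 y - 1)) = draws v bs (n(x := k, y := 0))"
        by (rule Cons.IH) (use Cons.prems n1 assms(3) False in \<open>auto simp: k_def\<close>)
      then show ?thesis by simp
    qed simp
    ultimately show ?thesis by (simp only: n1(1)[symmetric] add_mult_distrib)
  qed
  have other: "n i * draws v bs (n(i := n i - 1)) = n' i * draws v bs (n'(i := n' i - 1))"
    if i: "i \<in> {..<v} - {b} - {x, y}" for i
  proof -
    have "draws v bs (n(i := n i - 1)) = draws v bs (n'(i := n' i - 1))"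
      by (rule Cons.IH) (use Cons.prems i in auto)
    then show ?thesis using Cons.prems i by simp
  qed
  have wild': "n' x * draws v bs (n'(x := n' x - 1)) + n' y * draws v bs (n'(y := n' y - 1)) =
      (n x + n y) * draws v bs (n(x := k, y := 0))"
    by (rule wild) (use Cons.prems in auto)
  have "(\<Sum>i\<in>{..<v} - {b} - {x, y}. n i * draws v bs (n(i := n i - 1))) =
      (\<Sum>i\<in>{..<v} - {b} - {x, y}. n' i * draws v bs (n'(i := n' i - 1)))"
    by (rule sum.cong[OF refl other])
  then show ?case
    unfolding draws.simps split wild[of n, OF refl refl] wild' by simp
qed simp

text \<open>The falling factorial, unfolded from its largest factor as in drawing cards one by one;
  it vanishes for \<open>k > n\<close>.\<close>

fun falling :: "nat \<Rightarrow> nat \<Rightarrow> nat" where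
  "falling n 0 = 1"
| "falling n (Suc k) = n * falling (n - 1) k"

lemma falling_Suc_right: "falling n (Suc k) = falling n k * (n - k)"
proof (induction k arbitrary: n)
  case (Suc k)
  have "falling n (Suc (Suc k)) = n * falling (n - 1) (Suc k)" by simp
  also have "\<dots> = n * (falling (n - 1) k * (n - 1 - k))" by (simp only: Suc.IH)
  finally show ?case by (simp add: mult.assoc)
qed simp

lemma falling_pos_iff: "falling n k > 0 \<longleftrightarrow> k \<le> n"
proof (induction k arbitrary: n)
  case (Suc k)
  then show ?case using Suc.IH[of "n - 1"] by (cases n) auto
qed simp

text \<open>Pascal's rule, in the form that splits one more round into a hit, where \<open>k\<close>
  grows, and a miss.\<close>

lemma sum_choose_Suc:
  fixes t :: "nat \<Rightarrow> nat"
  shows "(\<Sum>k\<le>Suc a. (Suc a choose k) * t k) =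
    (\<Sum>k\<le>a. (a choose k) * t (Suc k)) + (\<Sum>k\<le>a. (a choose k) * t k)"
proof -
  have "(\<Sum>k\<le>Suc a. (Suc a choose k) * t k) = t 0 + (\<Sum>k\<le>a. (Suc a choose Suc k) * t (Suc k))"
    by (subst sum.atMost_Suc_shift) simp
  also have "\<dots> = (\<Sum>k\<le>a. (a choose k) * t (Suc k)) + (t 0 + (\<Sum>k\<le>a. (a choose Suc k) * t (Suc k)))"
    by (simp add: add_mult_distrib sum.distrib)
  also have "t 0 + (\<Sum>k\<le>a. (a choose Suc k) * t (Suc k)) = (\<Sum>k\<le>Suc a. (a choose k) * t k)"
    by (subst sum.atMost_Suc_shift) simp
  finally show ?thesis by simp
qed

lemma draws_Cons_remaining:
  assumes "x < v" "y < v" "x \<noteq> y"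
  shows "draws v (x # bs) n = n y * draws v bs (n(y := n y - 1)) +
    (\<Sum>i\<in>{..<v} - {x, y}. n i * draws v bs (n(i := n i - 1)))"
proof -
  have "{..<v} - {x} = insert y ({..<v} - {x, y})" using assms by auto
  then show ?thesis by simp
qed

text \<open>Among the \<open>a\<close> rounds naming \<open>u\<close>, choose the \<open>k\<close>
  that turn a \<open>w\<close>-card, which can happen in \<open>falling (n w) k\<close> ways.
  \<open>Q j l n\<close> stands for the count with \<open>l\<close> such cards removed and
  \<open>j\<close> rounds turning neither value. Keeping \<open>Q\<close> abstract allows the two
  nested uses in \<open>draws_expand\<close>.\<close>

lemma draws_replicate_expand:
  fixes Q :: "nat \<Rightarrow> nat \<Rightarrow> (nat \<Rightarrow> nat) \<Rightarrow> nat"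
  assumes "u < v" "w < v" "u \<noteq> w"
    and base: "\<And>n. draws v bs n = Q 0 0 n"
    and hit: "\<And>j l n. n w > 0 \<Longrightarrow> Q j l (n(w := n w - 1)) = Q j (Suc l) n"
    and miss: "\<And>j l n. (\<Sum>i\<in>{..<v} - {u, w}. n i * Q j l (n(i := n i - 1))) = Q (Suc j) l n"
  shows "draws v (replicate a u @ bs) n = (\<Sum>k\<le>a. (a choose k) * (falling (n w) k * Q (a - k) k n))"
proof (induction a arbitrary: n)
  case 0
  show ?case by (simp add: base)
next
  case (Suc a)
  have 1: "n w * draws v (replicate a u @ bs) (n(w := n w - 1)) =
      (\<Sum>k\<le>a. (a choose k) * (falling (n w) (Suc k) * Q (Suc a - Suc k) (Suc k) n))"
  proof (cases "n w = 0")
    case False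
    then have "Q j l (n(w := n w - 1)) = Q j (Suc l) n" for j l by (simp only: hit)
    then show ?thesis
      unfolding Suc.IH sum_distrib_left fun_upd_same falling.simps diff_Suc_Suc by (simp only: ac_simps)
  qed simp
  have "(\<Sum>i\<in>{..<v} - {u, w}. n i * draws v (replicate a u @ bs) (n(i := n i - 1))) =
      (\<Sum>i\<in>{..<v} - {u, w}. \<Sum>k\<le>a. (a choose k) * (falling (n w) k * (n i * Q (a - k) k (n(i := n i - 1)))))"
  proof (rule sum.cong[OF refl])
    fix i assume "i \<in> {..<v} - {u, w}"
    then have w: "(n(i := n i - 1)) w = n w" by simp
    show "n i * draws v (replicate a u @ bs) (n(i := n i - 1)) =
      (\<Sum>k\<le>a. (a choose k) * (falling (n w) k * (n i * Q (a - k) k (n(i := n i - 1)))))"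
      unfolding Suc.IH sum_distrib_left w by (simp only: ac_simps)
  qed
  also have "\<dots> = (\<Sum>k\<le>a. (a choose k) * (falling (n w) k * Q (Suc (a - k)) k n))"
    by (subst sum.swap) (simp only: sum_distrib_left[symmetric] miss)
  also have "\<dots> = (\<Sum>k\<le>a. (a choose k) * (falling (n w) k * Q (Suc a - k) k n))"
    by (rule sum.cong) (simp_all add: Suc_diff_le)
  finally have 2: "(\<Sum>i\<in>{..<v} - {u, w}. n i * draws v (replicate a u @ bs) (n(i := n i - 1))) =
      (\<Sum>k\<le>a. (a choose k) * (falling (n w) k * Q (Suc a - k) k n))" .
  show ?case
    unfolding replicate_Suc append_Cons draws_Cons_remaining[OF assms(1-3)] 1 2 sum_choose_Suc ..
qed

text \<open>The \<open>x\<close>- and \<open>y\<close>-cards, \<open>l\<close> of them removed, all count as \<open>x\<close>-cards, so the \<open>j\<close> bids on \<open>x\<close>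
  amount to bids that must avoid both values.\<close>

definition pooled :: "nat \<Rightarrow> nat \<Rightarrow> nat \<Rightarrow> nat list \<Rightarrow> nat \<Rightarrow> nat \<Rightarrow> (nat \<Rightarrow> nat) \<Rightarrow> nat" where
  "pooled v x y bs j l n = draws v (replicate j x @ bs) (n(x := n x + n y - l, y := 0))"

lemma pooled_hit:
  assumes "x \<noteq> y" "w \<in> {x, y}" "n w > 0"
  shows "pooled v x y bs j l (n(w := n w - 1)) = pooled v x y bs j (Suc l) n"
proof -
  have "(n(w := n w - 1))(x := (n(w := n w - 1)) x + (n(w := n w - 1)) y - l, y := 0) =
      n(x := n x + n y - Suc l, y := 0)"
    using assms by (auto simp: fun_eq_iff)
  then show ?thesis by (simp only: pooled_def)
qed

lemma pooled_miss:
  assumes "x < v" "y < v" "x \<noteq> y"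
  shows "(\<Sum>i\<in>{..<v} - {x, y}. n i * pooled v x y bs j l (n(i := n i - 1))) = pooled v x y bs (Suc j) l n"
proof -
  let ?n = "n(x := n x + n y - l, y := 0)"
  have "(n(i := n i - 1))(x := (n(i := n i - 1)) x + (n(i := n i - 1)) y - l, y := 0) = ?n(i := ?n i - 1)"
    if "i \<in> {..<v} - {x, y}" for i
    using that by (auto simp: fun_eq_iff)
  then have "n i * pooled v x y bs j l (n(i := n i - 1)) = ?n i * draws v (replicate j x @ bs) (?n(i := ?n i - 1))"
    if "i \<in> {..<v} - {x, y}" for i
    using that by (simp only: pooled_def) auto
  then have "(\<Sum>i\<in>{..<v} - {x, y}. n i * pooled v x y bs j l (n(i := n i - 1))) =
      (\<Sum>i\<in>{..<v} - {x, y}. ?n i * draws v (replicate j x @ bs) (?n(i := ?n i - 1)))"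
    by (rule sum.cong[OF refl])
  \<comment> \<open>The \<open>y\<close>-term drops out because \<open>?n y = 0\<close>.\<close>
  also have "\<dots> = draws v (x # replicate j x @ bs) ?n"
    unfolding draws_Cons_remaining[OF assms] by simp
  finally show ?thesis by (simp only: pooled_def replicate_Suc append_Cons)
qed

text \<open>The outer expansion treats the \<open>x\<close>-rounds, the inner one the
  \<open>y\<close>-rounds. An \<open>x\<close>-round never turns an \<open>x\<close>-card, so it
  leaves \<open>falling (n x) \<gamma>\<close> alone; the two kinds of rounds interact only through
  \<open>pooled\<close>, which sees the total \<open>\<alpha> + \<gamma>\<close>.\<close>

lemma draws_expand:
  assumes xy: "x < v" "y < v" "x \<noteq> y" and bs: "x \<notin> set bs" "y \<notin> set bs"
  shows "draws v (replicate a x @ replicate c y @ bs) n = (\<Sum>\<alpha>\<le>a. (a choose \<alpha>) * (falling (n y) \<alpha> *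
    (\<Sum>\<gamma>\<le>c. (c choose \<gamma>) * (falling (n x) \<gamma> * pooled v x y bs (a - \<alpha> + (c - \<gamma>)) (\<alpha> + \<gamma>) n))))"
proof (rule draws_replicate_expand[where Q = "\<lambda>j l n. \<Sum>\<gamma>\<le>c. (c choose \<gamma>) *
    (falling (n x) \<gamma> * pooled v x y bs (j + (c - \<gamma>)) (l + \<gamma>) n)", OF xy])
  fix n
  have "draws v (replicate c y @ bs) n =
      (\<Sum>\<gamma>\<le>c. (c choose \<gamma>) * (falling (n x) \<gamma> * pooled v x y bs (c - \<gamma>) \<gamma> n))"
  proof (rule draws_replicate_expand[OF xy(2,1) xy(3)[symmetric]])
    show "draws v bs n = pooled v x y bs 0 0 n" for n
      unfolding pooled_def by (simp only: replicate_0 append_Nil, rule draws_merge[OF xy bs]) (use xy in auto)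
    show "pooled v x y bs j l (n(x := n x - 1)) = pooled v x y bs j (Suc l) n" if "0 < n x" for j l n
      by (rule pooled_hit) (use that xy in auto)
    show "(\<Sum>i\<in>{..<v} - {y, x}. n i * pooled v x y bs j l (n(i := n i - 1))) = pooled v x y bs (Suc j) l n" for j l n
      unfolding insert_commute[of y x "{}"] by (rule pooled_miss[OF xy])
  qed
  then show "draws v (replicate c y @ bs) n = (\<Sum>\<gamma>\<le>c. (c choose \<gamma>) *
    (falling (n x) \<gamma> * pooled v x y bs (0 + (c - \<gamma>)) (0 + \<gamma>) n))" by simp
next
  fix j l and n :: "nat \<Rightarrow> nat"
  assume n: "0 < n y"
  have hit: "pooled v x y bs i k (n(y := n y - 1)) = pooled v x y bs i (Suc k) n" for i k
    by (rule pooled_hit) (use xy n in auto)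
  show "(\<Sum>\<gamma>\<le>c. (c choose \<gamma>) * (falling ((n(y := n y - 1)) x) \<gamma> *
       pooled v x y bs (j + (c - \<gamma>)) (l + \<gamma>) (n(y := n y - 1)))) =
     (\<Sum>\<gamma>\<le>c. (c choose \<gamma>) * (falling (n x) \<gamma> * pooled v x y bs (j + (c - \<gamma>)) (Suc l + \<gamma>) n))"
    unfolding hit using xy by simp
next
  fix j l and n :: "nat \<Rightarrow> nat"
  have "(\<Sum>i\<in>{..<v} - {x, y}. n i * (\<Sum>\<gamma>\<le>c. (c choose \<gamma>) * (falling ((n(i := n i - 1)) x) \<gamma> *
       pooled v x y bs (j + (c - \<gamma>)) (l + \<gamma>) (n(i := n i - 1))))) =
     (\<Sum>i\<in>{..<v} - {x, y}. \<Sum>\<gamma>\<le>c. (c choose \<gamma>) * (falling (n x) \<gamma> *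
       (n i * pooled v x y bs (j + (c - \<gamma>)) (l + \<gamma>) (n(i := n i - 1)))))"
    by (rule sum.cong) (simp_all add: sum_distrib_left ac_simps)
  also have "\<dots> = (\<Sum>\<gamma>\<le>c. (c choose \<gamma>) * (falling (n x) \<gamma> *
       pooled v x y bs (Suc (j + (c - \<gamma>))) (l + \<gamma>) n))"
    by (subst sum.swap) (simp only: sum_distrib_left[symmetric] pooled_miss[OF xy])
  finally show "(\<Sum>i\<in>{..<v} - {x, y}. n i * (\<Sum>\<gamma>\<le>c. (c choose \<gamma>) * (falling ((n(i := n i - 1)) x) \<gamma> *
       pooled v x y bs (j + (c - \<gamma>)) (l + \<gamma>) (n(i := n i - 1))))) =
     (\<Sum>\<gamma>\<le>c. (c choose \<gamma>) * (falling (n x) \<gamma> * pooled v x y bs (Suc j + (c - \<gamma>)) (l + \<gamma>) n))"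
    by simp
qed

text \<open>Only the first round differs. Its draws of other values cancel, which leaves the decks
  lacking one \<open>x\<close>-card or one \<open>y\<close>-card. Expanding both gives the same
  \<open>pooled\<close> factors with different falling factorials.\<close>

lemma draws_exchange:
  fixes a c :: nat
  assumes xy: "x < v" "y < v" "x \<noteq> y" and bs: "x \<notin> set bs" "y \<notin> set bs"
    and n: "n x = s" "n y = s" "s > 0"
  defines "r \<equiv> replicate a x @ replicate c y @ bs"
  shows "int (draws v (y # r) n) - int (draws v (x # r) n) =
    (\<Sum>\<alpha>\<le>a. \<Sum>\<gamma>\<le>c. int (a choose \<alpha>) * int (c choose \<gamma>) *
       (int (falling s \<alpha>) * int (falling s \<gamma>) * (int \<alpha> - int \<gamma>) *
        int (pooled v x y bs (a + c - (\<alpha> + \<gamma>)) (Suc (\<alpha> + \<gamma>)) n)))"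
proof -
  let ?K = "\<lambda>\<alpha> \<gamma>. pooled v x y bs (a + c - (\<alpha> + \<gamma>)) (Suc (\<alpha> + \<gamma>)) n"
  have K: "pooled v x y bs (a - \<alpha> + (c - \<gamma>)) (\<alpha> + \<gamma>) (n(w := n w - 1)) = ?K \<alpha> \<gamma>"
    if "\<alpha> \<le> a" "\<gamma> \<le> c" "w \<in> {x, y}" for \<alpha> \<gamma> w
  proof -
    have eq: "a - \<alpha> + (c - \<gamma>) = a + c - (\<alpha> + \<gamma>)" using that by simp
    have "0 < n w" using n that(3) by auto
    then show ?thesis unfolding eq by (rule pooled_hit[OF xy(3) that(3)])
  qed
  have X: "s * draws v r (n(x := n x - 1)) =
      (\<Sum>\<alpha>\<le>a. \<Sum>\<gamma>\<le>c. (a choose \<alpha>) * (c choose \<gamma>) * (falling s \<alpha> * falling s (Suc \<gamma>) * ?K \<alpha> \<gamma>))"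
    unfolding r_def draws_expand[OF xy bs] sum_distrib_left
    by (intro sum.cong refl, subst K) (use xy n in \<open>auto simp: ac_simps\<close>)
  have Y: "s * draws v r (n(y := n y - 1)) =
      (\<Sum>\<alpha>\<le>a. \<Sum>\<gamma>\<le>c. (a choose \<alpha>) * (c choose \<gamma>) * (falling s (Suc \<alpha>) * falling s \<gamma> * ?K \<alpha> \<gamma>))"
    unfolding r_def draws_expand[OF xy bs] sum_distrib_left
    by (intro sum.cong refl, subst K) (use xy n in \<open>auto simp: ac_simps\<close>)
  have "draws v (y # r) n + s * draws v r (n(y := n y - 1)) =
      draws v (x # r) n + s * draws v r (n(x := n x - 1))"
    using draws_Cons_remaining[OF xy, of r n] draws_Cons_remaining[OF xy(2,1) xy(3)[symmetric], of r n] n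
    by (simp add: insert_commute[of y x "{}"] del: draws.simps)
  then have "int (draws v (y # r) n) - int (draws v (x # r) n) =
      int (s * draws v r (n(x := n x - 1))) - int (s * draws v r (n(y := n y - 1)))"
    by linarith
  also have "\<dots> = (\<Sum>\<alpha>\<le>a. \<Sum>\<gamma>\<le>c. int (a choose \<alpha>) * int (c choose \<gamma>) *
       (int (falling s \<alpha>) * int (falling s \<gamma>) * (int \<alpha> - int \<gamma>) * int (?K \<alpha> \<gamma>)))"
  proof -
    \<comment> \<open>The factor is \<open>(s - \<gamma>) - (s - \<alpha>)\<close>. Truncated
      subtraction would spoil this beyond \<open>s\<close>, but there a falling factorial is
      zero.\<close>
    have d: "int (falling s \<alpha> * falling s (Suc \<gamma>)) - int (falling s (Suc \<alpha>) * falling s \<gamma>) =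
        int (falling s \<alpha>) * int (falling s \<gamma>) * (int \<alpha> - int \<gamma>)" for \<alpha> \<gamma>
    proof (cases "\<alpha> \<le> s \<and> \<gamma> \<le> s")
      case True
      then show ?thesis by (simp add: falling_Suc_right of_nat_diff algebra_simps del: falling.simps)
    next
      case False
      then have "falling s \<alpha> = 0 \<or> falling s \<gamma> = 0"
        by (metis falling_pos_iff neq0_conv)
      then show ?thesis by (auto simp: falling_Suc_right simp del: falling.simps)
    qed
    show ?thesis
      unfolding X Y of_nat_sum sum_subtractf[symmetric]
      by (intro sum.cong refl, unfold d[symmetric]) (simp add: algebra_simps del: falling.simps)
  qed
  finally show ?thesis .
qed

section \<open>Sign of the exchange sum\<close>

text \<open>Multiplying by \<open>k choose i\<close> makes
  \<open>(a choose i) * (c choose i)\<close> a common factor of both sides; what remains is strict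
  growth of a binomial coefficient in its upper index. For \<open>k > c\<close> the left side is
  zero.\<close>

lemma choose_mult_less:
  fixes a c i k :: nat
  assumes "c < a" "i < k" "k \<le> a" "i \<le> c"
  shows "(a choose i) * (c choose k) < (a choose k) * (c choose i)"
proof (cases "k \<le> c")
  case False
  then show ?thesis using assms by (simp add: binomial_eq_0)
next
  case True
  have mono: "(c - i choose (k - i)) < (a - i choose (k - i))"
  proof -
    have step: "(m choose j) < (Suc m choose j)" if "0 < j" "j \<le> m" for m j :: nat
      using that by (cases j) simp_all
    have "(c - i choose (k - i)) < (Suc (c - i) choose (k - i))"
      by (rule step) (use assms True in auto)
    also have "\<dots> \<le> (a - i choose (k - i))"
      by (rule binomial_right_mono) (use assms in auto)
    finally show ?thesis .
  qed
  have "(k choose i) * ((a choose i) * (c choose k)) = (a choose i) * (c choose i) * (c - i choose (k - i))"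
    using choose_mult[of i k c] assms True by (simp add: ac_simps)
  also have "\<dots> < (a choose i) * (c choose i) * (a - i choose (k - i))"
    using mono assms by simp
  also have "\<dots> = (k choose i) * ((a choose k) * (c choose i))"
    using choose_mult[of i k a] assms by (simp add: ac_simps)
  finally show ?thesis by simp
qed

lemma choose_mult_le:
  fixes a c i k :: nat
  assumes "c \<le> a" "i \<le> k"
  shows "(a choose i) * (c choose k) \<le> (a choose k) * (c choose i)"
proof (cases "c < a \<and> i < k \<and> k \<le> a \<and> i \<le> c")
  case True
  then show ?thesis using choose_mult_less[of c a i k] by simp
next
  case False
  then show ?thesis using assms by (cases "c = a \<or> i = k") (auto simp: binomial_eq_0)
qed

text \<open>As \<open>K\<close> sees only the sum of the indices, \<open>h\<close> changes sign when
  they are swapped. Hence \<open>2 * D\<close> is a sum of terms \<open>t\<close> whose two factors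
  never have opposite signs, and one positive term gives strictness.\<close>

lemma antisymmetric_sum_nonneg:
  fixes g K :: "nat \<Rightarrow> nat"
  assumes "c \<le> a"
  defines "D \<equiv> (\<Sum>\<alpha>\<le>a. \<Sum>\<gamma>\<le>c. int (a choose \<alpha>) * int (c choose \<gamma>) *
       (int (g \<alpha>) * int (g \<gamma>) * (int \<alpha> - int \<gamma>) * int (K (\<alpha> + \<gamma>))))"
  shows "0 \<le> D"
    and "c < a \<Longrightarrow> \<gamma>0 < \<alpha>0 \<Longrightarrow> \<alpha>0 \<le> a \<Longrightarrow> \<gamma>0 \<le> c \<Longrightarrow> 0 < g \<alpha>0 \<Longrightarrow> 0 < g \<gamma>0 \<Longrightarrow> 0 < K (\<alpha>0 + \<gamma>0) \<Longrightarrow> 0 < D"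
proof -
  define h where "h \<alpha> \<gamma> = int (g \<alpha>) * int (g \<gamma>) * (int \<alpha> - int \<gamma>) * int (K (\<alpha> + \<gamma>))" for \<alpha> \<gamma>
  define t where "t \<alpha> \<gamma> = (int (a choose \<alpha>) * int (c choose \<gamma>) - int (a choose \<gamma>) * int (c choose \<alpha>)) * h \<alpha> \<gamma>"
    for \<alpha> \<gamma>
  \<comment> \<open>Extending \<gamma> up to \<open>a\<close> adds only zero terms and makes the
    index range symmetric.\<close>
  have D: "D = (\<Sum>\<alpha>\<le>a. \<Sum>\<gamma>\<le>a. int (a choose \<alpha>) * int (c choose \<gamma>) * h \<alpha> \<gamma>)"
    unfolding D_def h_def
    by (intro sum.cong refl sum.mono_neutral_left) (use assms(1) in \<open>auto simp: binomial_eq_0\<close>)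
  have "D = (\<Sum>\<alpha>\<le>a. \<Sum>\<gamma>\<le>a. int (a choose \<gamma>) * int (c choose \<alpha>) * h \<gamma> \<alpha>)"
    unfolding D by (rule sum.swap)
  also have "\<dots> = (\<Sum>\<alpha>\<le>a. \<Sum>\<gamma>\<le>a. - (int (a choose \<gamma>) * int (c choose \<alpha>) * h \<alpha> \<gamma>))"
    by (intro sum.cong refl) (simp add: h_def algebra_simps)
  finally have D2: "2 * D = (\<Sum>\<alpha>\<le>a. \<Sum>\<gamma>\<le>a. t \<alpha> \<gamma>)"
    using D by (simp add: t_def sum.distrib[symmetric] sum_subtractf sum_negf left_diff_distrib)
  have t_ge: "0 \<le> t \<alpha> \<gamma>" for \<alpha> \<gamma>
  proof (cases "\<gamma> \<le> \<alpha>")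
    case True
    then have "0 \<le> h \<alpha> \<gamma>" by (simp add: h_def)
    moreover have "int (a choose \<gamma>) * int (c choose \<alpha>) \<le> int (a choose \<alpha>) * int (c choose \<gamma>)"
      using choose_mult_le[OF assms(1) True] by (metis of_nat_le_iff of_nat_mult)
    ultimately show ?thesis by (simp add: t_def)
  next
    case False
    then have "h \<alpha> \<gamma> \<le> 0" by (simp add: h_def mult_nonneg_nonpos mult_nonpos_nonneg)
    moreover have "int (a choose \<alpha>) * int (c choose \<gamma>) \<le> int (a choose \<gamma>) * int (c choose \<alpha>)"
      using choose_mult_le[OF assms(1), of \<alpha> \<gamma>] False by (metis nle_le of_nat_le_iff of_nat_mult)
    ultimately show ?thesis by (simp add: t_def mult_nonpos_nonpos)
  qed
  show "0 \<le> D" using D2 t_ge by (smt (verit) sum_nonneg)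
  show "0 < D" if ca: "c < a" and \<alpha>\<gamma>: "\<gamma>0 < \<alpha>0" "\<alpha>0 \<le> a" "\<gamma>0 \<le> c"
    and g: "0 < g \<alpha>0" "0 < g \<gamma>0" "0 < K (\<alpha>0 + \<gamma>0)"
  proof -
    have "0 < h \<alpha>0 \<gamma>0" using \<alpha>\<gamma> g by (simp add: h_def)
    moreover have "int (a choose \<gamma>0) * int (c choose \<alpha>0) < int (a choose \<alpha>0) * int (c choose \<gamma>0)"
      using choose_mult_less[OF ca \<alpha>\<gamma>] by (metis of_nat_less_iff of_nat_mult)
    ultimately have "0 < t \<alpha>0 \<gamma>0" by (simp add: t_def)
    also have "t \<alpha>0 \<gamma>0 \<le> (\<Sum>\<gamma>\<le>a. t \<alpha>0 \<gamma>)"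
      by (rule member_le_sum) (use \<alpha>\<gamma> ca t_ge in auto)
    also have "\<dots> \<le> (\<Sum>\<alpha>\<le>a. \<Sum>\<gamma>\<le>a. t \<alpha> \<gamma>)"
      by (rule member_le_sum[where f = "\<lambda>\<alpha>. \<Sum>\<gamma>\<le>a. t \<alpha> \<gamma>"]) (use \<alpha>\<gamma> t_ge in \<open>auto intro: sum_nonneg\<close>)
    finally show "0 < D" using D2 by simp
  qed
qed

section \<open>Existence of winning draws\<close>

lemma count_add_count_le_length:
  "l \<noteq> l' \<Longrightarrow> count (mset bs) l + count (mset bs) l' \<le> length bs"
  by (induction bs) auto

text \<open>Greedy: at most one value other than the next bid can have its bound attained, and if there is
  one, drawing it keeps all bounds valid.\<close>

lemma draws_pos:
  assumes "length bs \<le> (\<Sum>i<v. n i)" "set bs \<subseteq> {..<v}"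
    "\<And>i. i < v \<Longrightarrow> count (mset bs) i + n i \<le> (\<Sum>i<v. n i)"
  shows "0 < draws v bs n"
  using assms
proof (induction bs arbitrary: n)
  case (Cons b bs)
  define N where "N = (\<Sum>i<v. n i)"
  have len: "length bs < N" using Cons.prems(1) by (simp add: N_def)
  have bound: "count (mset (b # bs)) i + n i \<le> N" if "i < v" for i
    using Cons.prems(3)[OF that] by (simp add: N_def)
  have b: "b < v" using Cons.prems(2) by simp
  have "\<exists>i<v. i \<noteq> b \<and> 0 < n i \<and> (\<forall>l<v. l \<noteq> i \<longrightarrow> l \<noteq> b \<longrightarrow> count (mset bs) l + n l < N)"
  proof (cases "\<exists>l<v. l \<noteq> b \<and> count (mset bs) l + n l = N")
    case True
    then obtain l where l: "l < v" "l \<noteq> b" "count (mset bs) l + n l = N" by blast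
    have "count (mset bs) l \<le> length bs" by (metis count_le_size size_mset)
    then have "0 < n l" using l len by linarith
    \<comment> \<open>A second tight value \<open>k\<close> would give
      \<open>2 * N \<le> length bs + N\<close>.\<close>
    moreover have "count (mset bs) k + n k < N" if k: "k < v" "k \<noteq> l" "k \<noteq> b" for k
    proof -
      have "n l + n k \<le> N"
        using sum_lessThan_split2[OF l(1) k(1), of n] k by (simp add: N_def)
      then show ?thesis using count_add_count_le_length[of l k bs] k l len by linarith
    qed
    ultimately show ?thesis using l by blast
  next
    case False
    \<comment> \<open>Without a tight value any card other than \<open>b\<close> will do; one exists
      because the bid \<open>b\<close> itself counts in the bound for \<open>b\<close>.\<close>
    have "n b < N" using bound[OF b] by simp
    moreover have "N = n b + (\<Sum>i\<in>{..<v} - {b}. n i)"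
      using b by (simp add: N_def sum.remove)
    ultimately have "(\<Sum>i\<in>{..<v} - {b}. n i) \<noteq> 0" by linarith
    then obtain i where i: "i \<in> {..<v} - {b}" "n i \<noteq> 0" by (meson sum.not_neutral_contains_not_neutral)
    moreover have "count (mset bs) l + n l < N" if "l < v" "l \<noteq> b" for l
      using bound[OF that(1)] that False by (metis add_mset_add_single count_add_mset le_neq_implies_less mset.simps(2))
    ultimately show ?thesis by blast
  qed
  then obtain i where i: "i < v" "i \<noteq> b" "0 < n i"
    and slack: "\<And>l. l < v \<Longrightarrow> l \<noteq> i \<Longrightarrow> l \<noteq> b \<Longrightarrow> count (mset bs) l + n l < N" by blast
  define n' where "n' = n(i := n i - 1)"
  have N': "(\<Sum>i<v. n' i) = N - 1"
  proof -
    have "N = n i + (\<Sum>k\<in>{..<v} - {i}. n k)" using i by (simp add: N_def sum.remove)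
    moreover have "(\<Sum>k<v. n' k) = n i - 1 + (\<Sum>k\<in>{..<v} - {i}. n' k)"
      using i by (simp add: n'_def sum.remove)
    moreover have "(\<Sum>k\<in>{..<v} - {i}. n' k) = (\<Sum>k\<in>{..<v} - {i}. n k)"
      by (rule sum.cong) (auto simp: n'_def)
    ultimately show ?thesis using i by simp
  qed
  have "0 < draws v bs n'"
  proof (rule Cons.IH)
    show "length bs \<le> (\<Sum>i<v. n' i)" using N' len by simp
    show "set bs \<subseteq> {..<v}" using Cons.prems by simp
    fix l assume l: "l < v"
    \<comment> \<open>For \<open>b\<close> a bid was used up, for \<open>i\<close> a card, and every
      other value had slack.\<close>
    have "count (mset bs) l + n' l \<le> N - 1"
      using bound[OF l] slack[OF l] i by (cases "l = b"; cases "l = i") (auto simp: n'_def)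
    then show "count (mset bs) l + n' l \<le> (\<Sum>i<v. n' i)" by (simp only: N')
  qed
  then have "0 < n i * draws v bs (n(i := n i - 1))" using i by (simp add: n'_def)
  also have "\<dots> \<le> draws v (b # bs) n"
    unfolding draws.simps by (rule member_le_sum[where f = "\<lambda>i. n i * draws v bs (n(i := n i - 1))"]) (use i in auto)
  finally show ?case .
qed simp

section \<open>Moving one bid to another value\<close>

text \<open>Both bids are ordered so that they differ in the first entry only, as
  \<open>draws_exchange\<close> requires.\<close>

lemma exchange_bid_seq:
  fixes b :: "nat list" and x y :: nat
  assumes "x < length b" "y < length b" "x \<noteq> y" "0 < b ! x"
  defines "r \<equiv> filter (\<lambda>i. i \<noteq> x \<and> i \<noteq> y) (bid_seq b)"
    and "b' \<equiv> b[x := b ! x - 1, y := b ! y + 1]"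
  shows "\<And>i. count (mset (x # replicate (b ! x - 1) x @ replicate (b ! y) y @ r)) i =
      (if i < length b then b ! i else 0)"
    and "\<And>i. count (mset (y # replicate (b ! x - 1) x @ replicate (b ! y) y @ r)) i =
      (if i < length b' then b' ! i else 0)"
    and "\<And>i. count (mset r) i = (if i < length b \<and> i \<noteq> x \<and> i \<noteq> y then b ! i else 0)"
    and "set r \<subseteq> {..<length b} - {x, y}"
    and "length r + b ! x + b ! y = sum_list b"
    and "sum_list b' = sum_list b"
proof -
  show r: "count (mset r) i = (if i < length b \<and> i \<noteq> x \<and> i \<noteq> y then b ! i else 0)" for i
    unfolding r_def using count_bid_seq[of b i] by simp
  show 1: "count (mset (x # replicate (b ! x - 1) x @ replicate (b ! y) y @ r)) i =
      (if i < length b then b ! i else 0)" for i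
    using assms(1-4) r[of i] by auto
  show 2: "count (mset (y # replicate (b ! x - 1) x @ replicate (b ! y) y @ r)) i =
      (if i < length b' then b' ! i else 0)" for i
    using assms(1-4) r[of i] by (auto simp: b'_def nth_list_update)
  show "set r \<subseteq> {..<length b} - {x, y}"
  proof
    fix i assume "i \<in> set r"
    then have "0 < count (mset r) i" by simp
    then show "i \<in> {..<length b} - {x, y}" unfolding r by (auto split: if_splits)
  qed
  have "mset (bid_seq b) = mset (x # replicate (b ! x - 1) x @ replicate (b ! y) y @ r)"
    by (rule multiset_eqI) (simp only: 1 count_bid_seq)
  from mset_eq_length[OF this] show len: "length r + b ! x + b ! y = sum_list b"
    using assms(4) by (simp add: length_bid_seq)
  have "mset (bid_seq b') = mset (y # replicate (b ! x - 1) x @ replicate (b ! y) y @ r)"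
    by (rule multiset_eqI) (simp only: 2 count_bid_seq)
  from mset_eq_length[OF this] show "sum_list b' = sum_list b"
    using assms(4) len by (simp add: length_bid_seq)
qed

text \<open>The strict part asks for one positive term: \<open>\<alpha> \<le> s\<close> keeps the
  falling factorials nonzero, and the deck shown is that of \<open>pooled\<close>, short of the
  first card and \<alpha> + \<gamma> more.\<close>

lemma win_prob_exchange:
  fixes b :: "nat list" and v s x y :: nat
  assumes "length b = v" "x < v" "y < v" "b ! y < b ! x" "0 < s" "sum_list b \<le> s * v"
  defines "r \<equiv> filter (\<lambda>i. i \<noteq> x \<and> i \<noteq> y) (bid_seq b)"
    and "b' \<equiv> b[x := b ! x - 1, y := b ! y + 1]"
    and "a \<equiv> b ! x - 1" and "c \<equiv> b ! y"
  shows "win_prob b (replicate v s) \<le> win_prob b' (replicate v s)"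
    and "c < a \<Longrightarrow> \<gamma> < \<alpha> \<Longrightarrow> \<alpha> \<le> a \<Longrightarrow> \<gamma> \<le> c \<Longrightarrow> \<alpha> \<le> s \<Longrightarrow>
      0 < draws v (replicate (a + c - (\<alpha> + \<gamma>)) x @ r)
            (((!) (replicate v s))(x := 2 * s - Suc (\<alpha> + \<gamma>), y := 0)) \<Longrightarrow>
      win_prob b (replicate v s) < win_prob b' (replicate v s)"
proof -
  let ?n = "(!) (replicate v s)"
  have xy: "x < length b" "y < length b" "x \<noteq> y" "0 < b ! x" using assms by auto
  note ex = exchange_bid_seq[OF xy, folded r_def b'_def a_def c_def]
  have n: "?n x = s" "?n y = s" using assms by auto
  have le: "sum_list b \<le> sum_list (replicate v s)" using assms by (simp add: sum_list_replicate mult.commute)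
  define f :: real where "f = fact (sum_list (replicate v s) - sum_list b) / fact (sum_list (replicate v s))"
  have f: "0 < f" by (simp add: f_def)
  have W: "win_prob b (replicate v s) = real (draws v (x # replicate a x @ replicate c y @ r) ?n) * f"
    by (subst win_prob_eq_draws[OF ex(1) le]) (simp_all add: assms f_def)
  have W': "win_prob b' (replicate v s) = real (draws v (y # replicate a x @ replicate c y @ r) ?n) * f"
    by (subst win_prob_eq_draws[OF ex(2)]) (use le in \<open>simp_all add: ex(6) assms(1) f_def\<close>, simp add: b'_def assms(1))
  have r: "x \<notin> set r" "y \<notin> set r" by (simp_all add: r_def)
  have ca: "c \<le> a" using assms(4) by (simp add: a_def c_def)
  note D = draws_exchange[OF assms(2,3) xy(3) r n assms(5), of a c]
  note S = antisymmetric_sum_nonneg[OF ca, where g = "falling s" and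
      K = "\<lambda>t. pooled v x y r (a + c - t) (Suc t) ?n", folded D]
  show "win_prob b (replicate v s) \<le> win_prob b' (replicate v s)"
    using S(1) f unfolding W W' by (simp del: draws.simps)
  show "win_prob b (replicate v s) < win_prob b' (replicate v s)"
    if "c < a" "\<gamma> < \<alpha>" "\<alpha> \<le> a" "\<gamma> \<le> c" "\<alpha> \<le> s"
      "0 < draws v (replicate (a + c - (\<alpha> + \<gamma>)) x @ r) (?n(x := 2 * s - Suc (\<alpha> + \<gamma>), y := 0))"
  proof -
    have "0 < pooled v x y r (a + c - (\<alpha> + \<gamma>)) (Suc (\<alpha> + \<gamma>)) ?n"
      using that(6) unfolding pooled_def n mult_2 .
    then show ?thesis
      using S(2)[OF that(1-4)] that f unfolding W W' by (simp add: falling_pos_iff del: draws.simps)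
  qed
qed

text \<open>The bound on \<open>b ! x\<close> lets all remaining \<open>x\<close>-rounds avoid
  \<open>x\<close>. In \<open>others\<close>, the 2 accounts for the two cards of \<open>x\<close>
  or \<open>y\<close> missing from the pooled deck when \<open>t = 1\<close>; the greedy criterion
  then applies.\<close>

lemma win_prob_exchange_less:
  fixes b :: "nat list" and v s x y :: nat
  assumes v: "v \<ge> 3" and s: "0 < s" and b: "length b = v" "sum_list b \<le> s * v"
    and x: "x < v" "b ! x \<le> (v - 1) * s + 1" and y: "y < v" "b ! y + 2 \<le> b ! x"
    and others: "\<And>i. i < v \<Longrightarrow> i \<noteq> x \<Longrightarrow> i \<noteq> y \<Longrightarrow> b ! i + 2 \<le> (v - 1) * s"
  shows "win_prob b (replicate v s) < win_prob (b[x := b ! x - 1, y := b ! y + 1]) (replicate v s)"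
proof -
  define S a c where "S = (v - 2) * s" and "a = b ! x - 1" and "c = b ! y"
  define r where "r = filter (\<lambda>i. i \<noteq> x \<and> i \<noteq> y) (bid_seq b)"
  have v': "v = Suc (Suc (v - 2))" using v by simp
  have S1: "(v - 1) * s = S + s" unfolding S_def by (subst v') simp
  have S2: "s * v = S + 2 * s" unfolding S_def by (subst v') simp
  have S3: "s \<le> S" using mult_le_mono1[of 1 "v - 2" s] v unfolding S_def by linarith
  have xy: "x \<noteq> y" using y by auto
  have pos: "0 < b ! x" using y by simp
  note ex = exchange_bid_seq[OF x(1)[folded b(1)] y(1)[folded b(1)] xy pos, folded r_def]
  have ba: "b ! x = Suc a" using y by (simp add: a_def)
  have len: "length r + Suc a + c \<le> S + 2 * s" using ex(5) b(2) S2 ba by (simp add: c_def)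
  have a: "a \<le> S + s" "c < a" using x(2) y(2) S1 ba by (auto simp: c_def)
  \<comment> \<open>The rounds naming \<open>x\<close> or \<open>y\<close> can use at most the \<open>S\<close> cards of other values, so at least
    \<open>a + c - S\<close> of them turn an \<open>x\<close>- or \<open>y\<close>-card.\<close>
  define t where "t = max 1 (a + c - S)"
  \<comment> \<open>The \<open>max 1\<close> above leaves room for
    \<open>\<gamma> < \<alpha>\<close>; making \<alpha> as large as \<open>a\<close> and
    \<open>s\<close> permit then secures it.\<close>
  define \<alpha> where "\<alpha> = min t (min a s)"
  define \<gamma> where "\<gamma> = t - \<alpha>"
  \<comment> \<open>The cap \<open>s - 1\<close> reflects
    \<open>\<gamma> < \<alpha> \<le> s\<close>.\<close>
  have "a + c \<le> S + min a s + min c (s - 1)"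
    using a len s S3 by (cases "a \<le> s"; cases "c \<le> s - 1") (simp_all add: min_def)
  moreover have "1 \<le> min a s" using a s by simp
  ultimately have t: "1 \<le> t" "a + c - t \<le> S" "t \<le> min a s + min c (s - 1)"
    unfolding t_def by linarith+
  have \<alpha>\<gamma>: "\<alpha> + \<gamma> = t" "\<gamma> < \<alpha>" "\<alpha> \<le> a" "\<gamma> \<le> c" "\<alpha> \<le> s"
    using t a s by (auto simp: \<alpha>_def \<gamma>_def min_def split: if_splits)
  define n where "n = ((!) (replicate v s))(x := 2 * s - Suc t, y := 0)"
  have tot: "(\<Sum>i<v. n i) = 2 * s - Suc t + S"
  proof -
    have "card ({..<v} - {x, y}) = v - 2" using x y xy by (simp add: card_Diff_subset)
    moreover have "(\<Sum>i\<in>{..<v} - {x, y}. n i) = (\<Sum>i\<in>{..<v} - {x, y}. s)"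
      by (rule sum.cong) (auto simp: n_def)
    ultimately show ?thesis
      using sum_lessThan_split2[OF x(1) y(1) xy, of n] xy by (simp add: n_def S_def)
  qed
  have t2: "Suc t \<le> 2 * s" using t s by linarith
  have "0 < draws v (replicate (a + c - t) x @ r) n"
  proof (rule draws_pos)
    show "length (replicate (a + c - t) x @ r) \<le> (\<Sum>i<v. n i)"
      unfolding tot using len t t2 a by auto
    show "set (replicate (a + c - t) x @ r) \<subseteq> {..<v}" using ex(4) x b by auto
    fix i assume i: "i < v"
    \<comment> \<open>For \<open>t = 1\<close> this is \<open>others\<close>; for
      \<open>t = a + c - S\<close> it follows from \<open>len\<close> and
      \<open>s \<le> S\<close>.\<close>
    have "count (mset r) i + s \<le> 2 * s - Suc t + S" if "i \<noteq> x" "i \<noteq> y"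
    proof -
      have "b ! i = count (mset r) i" using ex(3)[of i] i that b by simp
      moreover from this have "b ! i \<le> length r" by (metis count_le_size size_mset)
      ultimately show ?thesis using others[OF i that] S1 len t2 S3 unfolding t_def by auto
    qed
    moreover have cx: "count (mset (replicate (a + c - t) x @ r)) x = a + c - t"
      and cy: "count (mset (replicate (a + c - t) x @ r)) y = 0"
      using ex(3)[of x] ex(3)[of y] xy by simp_all
    moreover have "n x = 2 * s - Suc t" "n y = 0" using xy by (simp_all add: n_def)
    moreover have "count (mset (replicate (a + c - t) x @ r)) i = count (mset r) i" "n i = s" if "i \<noteq> x" "i \<noteq> y"
      using that i by (simp_all add: n_def)
    ultimately have "count (mset (replicate (a + c - t) x @ r)) i + n i \<le> 2 * s - Suc t + S"
      using t(2) by (metis add.commute add_left_mono add_0 zero_le)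
    then show "count (mset (replicate (a + c - t) x @ r)) i + n i \<le> (\<Sum>i<v. n i)" by (simp only: tot)
  qed
  then show ?thesis
    using win_prob_exchange(2)[OF b(1) x(1) y(1) _ s b(2), folded r_def a_def c_def, of \<gamma> \<alpha>] a \<alpha>\<gamma>
    by (simp add: n_def ba flip: c_def)
qed

section \<open>Optimality of almost regular bids\<close>

text \<open>Exchanges need this description by pairwise differences. If these are at most 1, the
  mean \<open>m / v\<close> lies strictly within distance 1 of every entry.\<close>

lemma almost_regular_iff:
  assumes "v > 0"
  shows "b \<in> almost_regular v m \<longleftrightarrow>
    length b = v \<and> sum_list b = m \<and> (\<forall>i<v. \<forall>j<v. b ! i \<le> b ! j + 1)"
proof -
  have "b ! i \<le> b ! j + 1"
    if b: "\<forall>i<v. int (b ! i) \<in> {\<lfloor>real m / real v\<rfloor>, \<lceil>real m / real v\<rceil>}" and ij: "i < v" "j < v" for i j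
  proof -
    have ceil: "\<lceil>real m / real v\<rceil> \<le> \<lfloor>real m / real v\<rfloor> + 1" "\<lfloor>real m / real v\<rfloor> \<le> \<lceil>real m / real v\<rceil>"
      using ceiling_diff_floor_le_1[of "real m / real v"] floor_le_ceiling[of "real m / real v"] by linarith+
    have "int (b ! i) \<le> \<lceil>real m / real v\<rceil>" "\<lfloor>real m / real v\<rfloor> \<le> int (b ! j)"
      using b ij ceil(2) by force+
    then show ?thesis using ceil(1) by linarith
  qed
  moreover have "int (b ! i) \<in> {\<lfloor>real m / real v\<rfloor>, \<lceil>real m / real v\<rceil>}"
    if b: "length b = v" "sum_list b = m" "\<forall>i<v. \<forall>j<v. b ! i \<le> b ! j + 1" and i: "i < v" for i
  proof -
    have m: "m = (\<Sum>j<v. b ! j)" using b by (simp add: sum_list_sum_nth atLeast0LessThan)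
    \<comment> \<open>The inequality is strict at \<open>j = i\<close>.\<close>
    have "m < (\<Sum>j<v. b ! i + 1)"
      unfolding m by (rule sum_strict_mono_ex1) (use b i in auto)
    then have "real m < real v * (real (b ! i) + 1)"
      by (simp flip: of_nat_mult of_nat_Suc add: of_nat_less_iff algebra_simps)
    moreover have "(\<Sum>j<v. b ! i) < (\<Sum>j<v. b ! j + 1)"
      by (rule sum_strict_mono_ex1) (use b i in auto)
    then have "v * (b ! i) < m + v" unfolding m sum.distrib by simp
    then have "real v * real (b ! i) < real m + real v"
      by (metis of_nat_add of_nat_less_iff of_nat_mult)
    ultimately have up: "real m / real v < real (b ! i) + 1" and lo: "real (b ! i) - 1 < real m / real v"
      using assms by (simp_all add: field_simps)
    show ?thesis
    proof (cases "real (b ! i) \<le> real m / real v")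
      case True
      then have "\<lfloor>real m / real v\<rfloor> = int (b ! i)" using up by (intro floor_unique) auto
      then show ?thesis by simp
    next
      case False
      then have "\<lceil>real m / real v\<rceil> = int (b ! i)" using lo by (intro ceiling_unique) auto
      then show ?thesis by simp
    qed
  qed
  ultimately show ?thesis unfolding almost_regular_def by blast
qed

text \<open>Induction on the total deficit of \<open>b'\<close> against \<open>b\<close>: move a bid
  from a value \<open>i\<close> in surplus to a value \<open>j\<close> in deficit. Balance of
  \<open>b\<close> gives \<open>b' ! j < b ! j \<le> b ! i + 1 \<le> b' ! i\<close>, so the move
  never hurts.\<close>

lemma win_prob_le_balanced:
  fixes b b' :: "nat list" and v s :: nat
  assumes "0 < s" "length b = v" "sum_list b \<le> s * v"
    and bal: "\<And>i j. i < v \<Longrightarrow> j < v \<Longrightarrow> b ! i \<le> b ! j + 1"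
    and "length b' = v" "sum_list b' = sum_list b"
  shows "win_prob b' (replicate v s) \<le> win_prob b (replicate v s)"
  using assms(5,6)
proof (induction "\<Sum>i<v. b ! i - b' ! i" arbitrary: b' rule: less_induct)
  case less
  have sums: "sum_list b = (\<Sum>i<v. b ! i)" "sum_list b' = (\<Sum>i<v. b' ! i)"
    using less.prems assms(2) by (simp_all add: sum_list_sum_nth atLeast0LessThan)
  show ?case
  proof (cases "b' = b")
    case False
    have "\<exists>i<v. b ! i < b' ! i"
    proof (rule ccontr)
      assume "\<not> ?thesis"
      then have le: "\<And>i. i \<in> {..<v} \<Longrightarrow> b' ! i \<le> b ! i" by (meson lessThan_iff not_le_imp_less)
      then have "b' ! i = b ! i" if "i < v" for i
        using sum_mono_inv[of "(!) b'" "{..<v}" "(!) b" i] less.prems sums that by simp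
      then show False using False less.prems assms(2) by (auto intro!: nth_equalityI)
    qed
    then obtain i where i: "i < v" "b ! i < b' ! i" by blast
    have "\<exists>j<v. b' ! j < b ! j"
    proof (rule ccontr)
      assume "\<not> ?thesis"
      then have "\<And>j. j < v \<Longrightarrow> b ! j \<le> b' ! j" by (meson not_le_imp_less)
      then have "(\<Sum>i<v. b ! i) < (\<Sum>i<v. b' ! i)"
        by (intro sum_strict_mono_ex1) (use i in auto)
      then show False using less.prems sums by simp
    qed
    then obtain j where j: "j < v" "b' ! j < b ! j" by blast
    define b'' where "b'' = b'[i := b' ! i - 1, j := b' ! j + 1]"
    have ij: "i \<noteq> j" using i j by auto
    have gt: "b' ! j < b' ! i" using bal[OF j(1) i(1)] i j by simp
    have nth: "b'' ! k = (if k = j then b' ! j + 1 else if k = i then b' ! i - 1 else b' ! k)" if "k < v" for k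
      using that less.prems ij by (simp add: b''_def nth_list_update)
    have "win_prob b' (replicate v s) \<le> win_prob b'' (replicate v s)"
      unfolding b''_def by (rule win_prob_exchange(1)) (use less.prems assms i j gt in auto)
    also have "\<dots> \<le> win_prob b (replicate v s)"
    proof (rule less.hyps)
      show "(\<Sum>k<v. b ! k - b'' ! k) < (\<Sum>k<v. b ! k - b' ! k)"
        by (rule sum_strict_mono_ex1) (use i j nth in \<open>auto intro!: bexI[of _ j]\<close>)
      show "length b'' = v" using less.prems by (simp add: b''_def)
      show "sum_list b'' = sum_list b"
        unfolding b''_def using exchange_bid_seq(6)[of i b' j] i j ij less.prems by simp
    qed
    finally show ?thesis .
  qed simp
qed

section \<open>Improving unbalanced bids\<close>

text \<open>Here \<open>x\<close> is named more often than there are other cards. Moving bids to a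
  fixed \<open>y\<close> does not hurt, and once the surplus is exactly 1 the next move is
  strict.\<close>

lemma large_bid_improvable:
  fixes b :: "nat list" and v s x k :: nat
  assumes v: "v \<ge> 3" and s: "0 < s" and "length b = v" "sum_list b \<le> s * v"
    and x: "x < v" and "b ! x = (v - 1) * s + 1 + k"
  shows "\<exists>b'. length b' = v \<and> sum_list b' = sum_list b \<and> win_prob b (replicate v s) < win_prob b' (replicate v s)"
proof -
  have "\<exists>y<v. y \<noteq> x" using v by presburger
  then obtain y where y: "y < v" "y \<noteq> x" by blast
  have S: "s * v = (v - 1) * s + s" "2 * s \<le> (v - 1) * s"
    using v by (cases v, auto simp: mult.commute)
  show ?thesis
    using assms(3,4,6)
  proof (induction k arbitrary: b)
    case (0 b)
    have small: "b ! i + 1 \<le> s" if "i < v" "i \<noteq> x" for i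
      using sum_lessThan_split2[OF x that(1), of "(!) b"] that 0 S
      by (simp add: sum_list_sum_nth atLeast0LessThan)
    show ?case
    proof (intro exI conjI)
      show "win_prob b (replicate v s) < win_prob (b[x := b ! x - 1, y := b ! y + 1]) (replicate v s)"
      proof (rule win_prob_exchange_less[OF v s 0(1,2) x _ y(1)])
        show "b ! i + 2 \<le> (v - 1) * s" if "i < v" "i \<noteq> x" "i \<noteq> y" for i
          using small[OF that(1,2)] S s by linarith
      qed (use 0 small[OF y] S s in linarith)+
    qed (use 0 x y exchange_bid_seq(6)[of x b y] in auto)
  next
    case (Suc k b)
    have "b ! x + b ! y \<le> sum_list b"
      using sum_lessThan_split2[OF x y(1) y(2)[symmetric], of "(!) b"] Suc.prems(1)
      by (simp add: sum_list_sum_nth atLeast0LessThan)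
    then have "b ! y < b ! x" using Suc.prems S by linarith
    let ?b = "b[x := b ! x - 1, y := b ! y + 1]"
    have sum: "sum_list ?b = sum_list b" using exchange_bid_seq(6)[of x b y] Suc.prems x y by simp
    have "win_prob b (replicate v s) \<le> win_prob ?b (replicate v s)"
      by (rule win_prob_exchange(1)) (use Suc.prems x y s \<open>b ! y < b ! x\<close> in auto)
    moreover have "\<exists>b'. length b' = v \<and> sum_list b' = sum_list ?b \<and> win_prob ?b (replicate v s) < win_prob b' (replicate v s)"
      by (rule Suc.IH) (use Suc.prems sum x y in \<open>auto simp: nth_list_update\<close>)
    ultimately show ?case using sum by (auto intro: le_less_trans)
  qed
qed

text \<open>Taking a most and a least named value for \<open>x\<close> and \<open>y\<close> makes
  \<open>b ! x\<close> bound every third entry, which leaves few ways for the hypotheses of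
  \<open>win_prob_exchange_less\<close> to fail.\<close>

lemma unbalanced_bid_improvable:
  fixes b :: "nat list" and v s :: nat
  assumes v: "v \<ge> 3" and s: "0 < s" and b: "length b = v" "sum_list b \<le> s * v"
    and unbalanced: "i0 < v" "j0 < v" "b ! j0 + 2 \<le> b ! i0"
    and exc: "\<not> (v = 3 \<and> s = 1 \<and> sum_list b = 3)"
  shows "\<exists>b'. length b' = v \<and> sum_list b' = sum_list b \<and> win_prob b (replicate v s) < win_prob b' (replicate v s)"
proof -
  have fin: "finite ((!) b ` {..<v})" "(!) b ` {..<v} \<noteq> {}" using v by (auto simp: lessThan_empty_iff)
  obtain x where x: "x < v" "\<And>i. i < v \<Longrightarrow> b ! i \<le> b ! x"
  proof -
    obtain x where "x < v" "b ! x = Max ((!) b ` {..<v})" using Max_in[OF fin] by force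
    then show thesis using that[of x] Max_ge[OF fin(1)] by simp
  qed
  obtain y where y: "y < v" "\<And>i. i < v \<Longrightarrow> b ! y \<le> b ! i"
  proof -
    obtain y where "y < v" "b ! y = Min ((!) b ` {..<v})" using Min_in[OF fin] by force
    then show thesis using that[of y] Min_le[OF fin(1)] by simp
  qed
  have gap: "b ! y + 2 \<le> b ! x" using x(2)[OF unbalanced(1)] y(2)[OF unbalanced(2)] unbalanced(3) by linarith
  then have xy: "x \<noteq> y" by auto
  consider "(v - 1) * s + 1 < b ! x"
    | "b ! x \<le> (v - 1) * s + 1" "\<forall>i<v. i \<noteq> x \<longrightarrow> i \<noteq> y \<longrightarrow> b ! i + 2 \<le> (v - 1) * s"
    | i where "i < v" "i \<noteq> x" "i \<noteq> y" "(v - 1) * s < b ! i + 2"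
    by (meson not_le_imp_less)
  then show ?thesis
  proof cases
    case 1
    then show ?thesis
      using large_bid_improvable[OF v s b x(1), of "b ! x - ((v - 1) * s + 1)"] by simp
  next
    case 2
    then show ?thesis
      using win_prob_exchange_less[OF v s b x(1) 2(1) y(1) gap] exchange_bid_seq(6)[of x b y] x y xy b gap
      by (intro exI[of _ "b[x := b ! x - 1, y := b ! y + 1]"]) auto
  next
    \<comment> \<open>Only \<open>(3, 3, 0)\<close> with \<open>s = 2\<close> and \<open>(2, 2, 0, 0)\<close> with \<open>s = 1\<close>, up to order, remain: the first
      exchange gains nothing, the second one does.\<close>
    case (3 i)
    have sum: "b ! x + b ! y + (\<Sum>k\<in>{..<v} - {x, y}. b ! k) = sum_list b"
      using sum_lessThan_split2[OF x(1) y(1) xy, of "(!) b"] b by (simp add: sum_list_sum_nth atLeast0LessThan)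
    have "(\<Sum>k\<in>{..<v} - {x, y}. b ! k) = b ! i + (\<Sum>k\<in>{..<v} - {x, y} - {i}. b ! k)"
      by (rule sum.remove) (use 3 in auto)
    with sum have sum3: "b ! x + b ! y + b ! i + (\<Sum>k\<in>{..<v} - {x, y} - {i}. b ! k) = sum_list b" by simp
    define w where "w = v - 2"
    have w: "v = w + 2" "1 \<le> w" using v by (simp_all add: w_def)
    have i: "w * s + s \<le> b ! i + 1" using 3(4) w by (simp add: algebra_simps)
    have ix: "b ! i \<le> b ! x" using x(2) 3(1) .
    have tot: "b ! x + b ! y + b ! i \<le> w * s + 2 * s" using sum3 b(2) w by (simp add: algebra_simps)
    \<comment> \<open>Both \<open>b ! x\<close> and \<open>b ! i\<close> are at least
      \<open>w * s + s - 1\<close>, while their sum is at most \<open>w * s + 2 * s\<close>.\<close>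
    have ws: "w * s \<le> 2" using i ix tot by linarith
    have "w \<le> w * s" "s \<le> w * s" using s w by auto
    then have "w \<le> 2" "s \<le> 2" using ws by linarith+
    then have "(w = 1 \<or> w = 2) \<and> (s = 1 \<or> s = 2)" using s w by linarith
    then consider "w = 1" "s = 1" | "w = 1" "s = 2" | "w = 2" "s = 1" using ws by force
    \<comment> \<open>The second exchange moves a bid from \<open>i\<close> to \<open>z\<close>: to
      \<open>y\<close> again for \<open>(3, 3, 0)\<close>, to the other unnamed value for
      \<open>(2, 2, 0, 0)\<close>.\<close>
    then obtain z where z: "z < v" "z \<noteq> x" "z \<noteq> i" and bi: "b ! i = (v - 1) * s - 1" "b ! x = b ! i" "b ! y = 0"
      and bz: "if z = y then v = 3 \<and> s = 2 else v = 4 \<and> s = 1 \<and> b ! z = 0"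
    proof cases
      assume "w = 1" "s = 1"
      then have "v = 3" "sum_list b \<le> 3" "1 \<le> b ! i" using w b i by auto
      \<comment> \<open>The gap gives \<open>b ! x \<ge> 2\<close>, so the sum would be 3, the
        excluded case.\<close>
      then show thesis using exc gap sum3 \<open>s = 1\<close> by linarith
    next
      assume "w = 1" "s = 2"
      then show thesis using that[of y] w i ix tot y xy 3 by simp
    next
      assume w2: "w = 2" and s1: "s = 1"
      have "\<exists>z<4. z \<noteq> x \<and> z \<noteq> y \<and> z \<noteq> i" by presburger
      then obtain z where z: "z < 4" "z \<noteq> x" "z \<noteq> y" "z \<noteq> i" by blast
      have "b ! z \<le> (\<Sum>k\<in>{..<v} - {x, y} - {i}. b ! k)"
        by (rule member_le_sum) (use z w w2 in auto)
      then show thesis using that[of z] z w i ix tot y xy 3 sum3 b w2 s1 by simp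
    qed
    let ?b = "b[x := b ! x - 1, y := b ! y + 1]"
    have len: "length ?b = v" using b by simp
    have sum': "sum_list ?b = sum_list b" using exchange_bid_seq(6)[of x b y] x y xy b gap by simp
    have nth: "?b ! k = (if k = y then 1 else if k = x then b ! i - 1 else b ! k)" if "k < v" for k
      using that b xy bi by (simp add: nth_list_update)
    have "win_prob b (replicate v s) \<le> win_prob ?b (replicate v s)"
      by (rule win_prob_exchange(1)) (use b x y s gap in auto)
    also have "\<dots> < win_prob (?b[i := ?b ! i - 1, z := ?b ! z + 1]) (replicate v s)"
    proof (rule win_prob_exchange_less[OF v s len _ 3(1) _ z(1)])
      show "sum_list ?b \<le> s * v" using b sum' by simp
      have "?b ! i = b ! i" using nth[OF 3(1)] 3 by simp
      then show "?b ! i \<le> (v - 1) * s + 1" using bi(1) by linarith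
      show "?b ! z + 2 \<le> ?b ! i" using nth[OF 3(1)] nth[OF z(1)] 3 bi bz z by (auto split: if_splits)
      fix k assume k: "k < v" "k \<noteq> i" "k \<noteq> z"
      \<comment> \<open>These are all the values, so only \<open>x\<close> and \<open>y\<close> need
        checking.\<close>
      have "{x, y, i, z} = {..<v}"
        by (rule card_subset_eq) (use z x(1) y(1) xy 3(1-3) bz in \<open>auto split: if_splits simp: card_insert_if\<close>)
      then have "k = x \<or> k = y" using k bz by (auto split: if_splits)
      then show "?b ! k + 2 \<le> (v - 1) * s"
        using nth[OF k(1)] bi bz by (auto split: if_splits)
    qed
    finally have less: "win_prob b (replicate v s) < win_prob (?b[i := ?b ! i - 1, z := ?b ! z + 1]) (replicate v s)" .
    have "0 < ?b ! i" using nth[OF 3(1)] 3 bi(2) gap by simp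
    then have "sum_list (?b[i := ?b ! i - 1, z := ?b ! z + 1]) = sum_list ?b"
      by (intro exchange_bid_seq(6)) (use len z 3 in simp_all)
    with less sum' b(1) show ?thesis
      by (intro exI[of _ "?b[i := ?b ! i - 1, z := ?b ! z + 1]"]) (simp only: length_list_update simp_thms)
  qed
qed

section \<open>The optimal bids, including the exceptional deck\<close>

theorem theorem1p5:
  fixes v s m :: nat
  assumes "v \<ge> 3" and "s \<ge> 1" and "m \<le> s * v"
  shows "(replicate v s = [1, 1, 1] \<and> m = 3 \<longrightarrow>
            optimal_bids (replicate v s) m = insert [1, 1, 1] (permutations_of_multiset {#2, 1, 0#}) \<and>
            card (optimal_bids (replicate v s) m) = 7) \<and>
         (\<not> (replicate v s = [1, 1, 1] \<and> m = 3) \<longrightarrow>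
            optimal_bids (replicate v s) m = almost_regular v m)"
proof (intro conjI impI)
  assume "\<not> (replicate v s = [1, 1, 1] \<and> m = 3)"
  then have exc: "\<not> (v = 3 \<and> s = 1 \<and> m = 3)" by (auto simp: numeral_3_eq_3)
  have s: "0 < s" using assms by simp
  show "optimal_bids (replicate v s) m = almost_regular v m"
  proof (intro equalityI subsetI)
    fix b assume "b \<in> optimal_bids (replicate v s) m"
    then have b: "length b = v" "sum_list b = m"
      and opt: "\<And>b'. length b' = v \<Longrightarrow> sum_list b' = m \<Longrightarrow> win_prob b' (replicate v s) \<le> win_prob b (replicate v s)"
      by (auto simp: optimal_bids_def)
    have "b ! i \<le> b ! j + 1" if ij: "i < v" "j < v" for i j
    proof (rule ccontr)
      assume "\<not> ?thesis"
      then have "b ! j + 2 \<le> b ! i" by simp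
      then obtain b' where "length b' = v" "sum_list b' = m" "win_prob b (replicate v s) < win_prob b' (replicate v s)"
        using unbalanced_bid_improvable[OF assms(1) s b(1) _ ij] b(2) assms(3) exc by blast
      then show False using opt[of b'] by simp
    qed
    then show "b \<in> almost_regular v m" using b assms(1) by (simp add: almost_regular_iff)
  next
    fix b assume "b \<in> almost_regular v m"
    then have b: "length b = v" "sum_list b = m" "\<And>i j. i < v \<Longrightarrow> j < v \<Longrightarrow> b ! i \<le> b ! j + 1"
      using assms(1) by (simp_all add: almost_regular_iff)
    then show "b \<in> optimal_bids (replicate v s) m"
      using win_prob_le_balanced[OF s b(1) _ b(3)] assms(3) by (simp add: optimal_bids_def)
  qed
next
  assume "replicate v s = [1, 1, 1] \<and> m = 3"
  then have *: "replicate v s = [1, 1, 1]" "m = 3" by auto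
  \<comment> \<open>Three rounds exhaust this deck, so \<open>W\<close> counts the winners among its
    6 orders; only ten bids need evaluation.\<close>
  define W where "W b = draws 3 (bid_seq b) ((!) [1, 1, 1])" for b
  let ?ties = "{[1, 1, 1], [2, 1, 0], [2, 0, 1], [1, 2, 0], [1, 0, 2], [0, 2, 1], [0, 1, 2]} :: nat list set"
  let ?losses = "{[3, 0, 0], [0, 3, 0], [0, 0, 3]} :: nat list set"
  have bids: "b \<in> ?ties \<or> b \<in> ?losses" if b: "length b = 3" "sum_list b = 3" for b
  proof -
    from b(1) obtain p q r where pqr: "b = [p, q, r]" by (auto simp: numeral_3_eq_3 length_Suc_conv)
    with b have "p \<in> {0, 1, 2, 3}" "q \<in> {0, 1, 2, 3}" "r = 3 - p - q" "p + q \<le> 3" by auto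
    with pqr show ?thesis by (elim insertE emptyE) simp_all
  qed
  have W: "win_prob b [1, 1, 1] = W b / 6" if "length b = 3" "sum_list b = 3" for b
    using that unfolding W_def by (subst win_prob_eq_draws[OF count_bid_seq]) (simp_all add: fact_numeral numeral_3_eq_3)
  have tie: "W b = 2" "length b = 3" "sum_list b = 3" if "b \<in> ?ties" for b
    using that
    by (elim insertE emptyE;
        simp add: W_def bid_seq_def numeral_2_eq_2 numeral_3_eq_3 lessThan_Suc insert_Diff_if)+
  have loss: "W b = 0" if "b \<in> ?losses" for b
    using that
    by (elim insertE emptyE;
        simp add: W_def bid_seq_def numeral_2_eq_2 numeral_3_eq_3 lessThan_Suc insert_Diff_if)
  have W_le: "W b \<le> 2" if "length b = 3" "sum_list b = 3" for b
    using bids[OF that] tie(1)[of b] loss[of b] by (metis order_refl zero_le)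
  have opt: "optimal_bids (replicate v s) m = ?ties"
  proof (intro equalityI subsetI)
    fix b assume "b \<in> optimal_bids (replicate v s) m"
    then have b: "length b = 3" "sum_list b = 3" and le: "win_prob [1, 1, 1] [1, 1, 1] \<le> win_prob b [1, 1, 1]"
      unfolding optimal_bids_def * by auto
    have "W [1, 1, 1] = 2" by (rule tie) simp
    with le have "W b \<noteq> 0" using W[OF b] W[of "[1, 1, 1]"] by simp
    then show "b \<in> ?ties" using bids[OF b] loss[of b] by metis
  next
    fix b assume b: "b \<in> ?ties"
    have "win_prob b' [1, 1, 1] \<le> win_prob b [1, 1, 1]" if b': "length b' = 3" "sum_list b' = 3" for b'
      using W[OF b'] W[OF tie(2)[OF b] tie(3)[OF b]] tie(1)[OF b] W_le[OF b'] by simp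
    then show "b \<in> optimal_bids (replicate v s) m"
      using tie(2,3)[OF b] unfolding optimal_bids_def * by simp
  qed
  show "optimal_bids (replicate v s) m = insert [1, 1, 1] (permutations_of_multiset {#2, 1, 0#})"
    unfolding opt
  proof (intro equalityI subsetI)
    fix b assume b: "b \<in> insert [1, 1, 1] (permutations_of_multiset {#2, 1, 0::nat#})"
    show "b \<in> ?ties"
    proof (cases "b = [1, 1, 1]")
      case False
      then have ms: "mset b = {#2, 1, 0#}" using b by (simp add: permutations_of_multiset_def)
      have "size (mset b) = 3" "sum_mset (mset b) = 3" unfolding ms by simp_all
      then have b3: "length b = 3" "sum_list b = 3" by (simp_all add: sum_mset_sum_list)
      have "set b = {2, 1, 0}" using arg_cong[OF ms, of set_mset] by simp
      then have "3 \<notin> set b" by simp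
      then have "b \<notin> ?losses" by auto
      then show ?thesis using bids[OF b3] by metis
    qed simp
  qed (auto simp: permutations_of_multiset_def)
  show "card (optimal_bids (replicate v s) m) = 7"
    unfolding opt by simp
qed

end
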